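(* Let $a,m\in\mathbb{Z}$ with $m\neq 0$, and let $s$ and $m_s$ be the integers associated with $(a,m)$ by the procedure described in the context. Then $$a^{\varphi(m_s)+s}\equiv a^s \pmod m .$$
   Context: $\varphi$ is Euler's totient function, extended to nonzero integers by $\varphi(-k)=\varphi(k)$; $\gcd$ denotes the positive greatest common divisor; congruence modulo $-k$ means congruence modulo $k$; $0^0=1$. Given integers $a$ and $m\ne 0$, define $s$ and $m_s$ as follows. Put $d_0=\gcd(a,m)$. If $d_0=1$, set $s=0$ and $m_0=m$. Otherwise put $m_0=m/d_0$ and define recursively, for $i\ge 1$, $d_i=\gcd(d_{i-1},m_{i-1})$ and $m_i=m_{i-1}/d_i$. After finitely many steps one reaches an index $i$ with $d_i=1$; $s$ is the smallest index with $d_s=1$, and $m_s$ is the corresponding term (so $m_s=m_{s-1}$ when $s\ge1$). Equivalently, start with $s=0$, $m_s=m$, $d=\gcd(a,m)$, and while $d\ne 1$ replace $s$ by $s+1$, $m_s$ by $m_s/d$, and then $d$ by $\gcd(d,m_s)$ (with the new $m_s$). *)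

theory Defs
  imports "HOL-Number_Theory.Number_Theory"
begin

text \<open>The numbers \<open>d\<^sub>i\<close> and \<open>m\<^sub>i\<close> attached to \<open>(a, m)\<close>, continued past the stopping index. If
  \<open>d\<^sub>0 = 1\<close>, then \<open>m div d\<^sub>0 = m\<close>, so the case \<open>m\<^sub>0 = m\<close> needs no separate treatment. All
  divisions are exact, so \<open>div\<close> is division in the integers also for negative \<open>m\<close>.\<close>

fun d_seq :: "int \<Rightarrow> int \<Rightarrow> nat \<Rightarrow> int" and m_seq :: "int \<Rightarrow> int \<Rightarrow> nat \<Rightarrow> int" where
  "d_seq a m 0 = gcd a m"
| "d_seq a m (Suc i) = gcd (d_seq a m i) (m_seq a m i)"
| "m_seq a m 0 = m div d_seq a m 0"
| "m_seq a m (Suc i) = m_seq a m i div d_seq a m (Suc i)"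

definition stop_index :: "int \<Rightarrow> int \<Rightarrow> nat" where
  "stop_index a m = (LEAST i. d_seq a m i = 1)"

definition stop_modulus :: "int \<Rightarrow> int \<Rightarrow> int" where
  "stop_modulus a m = m_seq a m (stop_index a m)"

text \<open>Euler's function on nonzero integers, with \<open>\<phi>(-k) = \<phi>(k)\<close>.\<close>

definition totient_int :: "int \<Rightarrow> nat" where
  "totient_int k = totient (nat \<bar>k\<bar>)"

lemma d_seq_dvd: "d_seq a m (Suc i) dvd m_seq a m i"
  by simp

lemma m_seq_nonzero:
  assumes "m \<noteq> 0"
  shows "m_seq a m i \<noteq> 0"
proof (induction i)
  case 0
  then show ?case using assms by (simp add: dvd_div_eq_0_iff)
next
  case (Suc i)
  then show ?case by (simp add: dvd_div_eq_0_iff)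
qed

text \<open>The index sought by \<open>LEAST\<close> exists: the \<open>\<bar>m\<^sub>i\<bar>\<close> decrease strictly as long as \<open>d\<^sub>i \<noteq> 1\<close>.\<close>

lemma stop_index_exists:
  assumes "m \<noteq> 0"
  shows "\<exists>i. d_seq a m i = 1"
proof (rule ccontr)
  assume *: "\<nexists>i. d_seq a m i = 1"
  have step: "\<bar>m_seq a m (Suc i)\<bar> < \<bar>m_seq a m i\<bar>" for i
  proof -
    let ?d = "d_seq a m (Suc i)" and ?n = "m_seq a m i" and ?n' = "m_seq a m (Suc i)"
    have nz: "?n \<noteq> 0" "?n' \<noteq> 0"
      using m_seq_nonzero[OF assms] by blast+
    have eq: "?n = ?d * ?n'" by simp
    have "?d \<ge> 0" by simp
    moreover have "?d \<noteq> 0" using eq nz by fastforce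
    moreover have "?d \<noteq> 1" using * by blast
    ultimately have d: "?d > 1" by linarith
    have "\<bar>?n\<bar> = ?d * \<bar>?n'\<bar>"
      using eq d by (metis abs_mult abs_of_pos less_trans zero_less_one)
    moreover have "1 * \<bar>?n'\<bar> < ?d * \<bar>?n'\<bar>"
      by (rule mult_strict_right_mono) (use d nz in auto)
    ultimately show ?thesis by linarith
  qed
  have "\<bar>m_seq a m i\<bar> + int i \<le> \<bar>m_seq a m 0\<bar>" for i
  proof (induction i)
    case 0
    show ?case by simp
  next
    case (Suc i)
    then show ?case using step[of i] by linarith
  qed
  from this[of "Suc (nat \<bar>m_seq a m 0\<bar>)"] show False by linarith
qed

end

theory Submission
  imports Defs
begin

text \<open>Every \<open>d\<^sub>i\<close> divides \<open>a\<close>, and \<open>m = d\<^sub>0 \<cdots> d\<^bsub>s-1\<^esub> m\<^sub>s\<close> since \<open>d\<^sub>s = 1\<close>; hence \<open>m\<close> divides \<open>a\<^sup>s m\<^sub>s\<close>.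
  Moreover \<open>gcd a m\<^sub>i = d\<^bsub>i+1\<^esub>\<close>, so \<open>a\<close> is coprime to \<open>m\<^sub>s\<close>, and Euler's theorem modulo \<open>m\<^sub>s\<close>,
  multiplied by \<open>a\<^sup>s\<close>, gives the congruence modulo \<open>m\<close>.\<close>

lemma d_seq_dvd_base: "d_seq a m i dvd a"
  by (induction i) (auto intro: dvd_trans)

lemma prod_d_seq_mult_m_seq: "(\<Prod>j\<le>i. d_seq a m j) * m_seq a m i = m"
  by (induction i) (simp_all add: mult.assoc)

lemma prod_d_seq_dvd_power: "(\<Prod>j<i. d_seq a m j) dvd a ^ i"
  using prod_dvd_prod[of "{..<i}" "d_seq a m" "\<lambda>_. a"] by (simp add: d_seq_dvd_base)

text \<open>Each \<open>m_seq\<close> term divides its predecessor (the first divides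
  \<open>m\<close>), so its gcd with \<open>a\<close> factors through the predecessor's gcd with
  \<open>a\<close>, known by induction.\<close>

lemma gcd_m_seq: "gcd a (m_seq a m i) = d_seq a m (Suc i)"
proof -
  have *: "gcd a n' = gcd (gcd a n) n'" if "n' dvd n" for n n' :: int
    using that by (simp add: gcd.assoc gcd_proj2_if_dvd)
  show ?thesis
  proof (induction i)
    case 0
    have "m_seq a m 0 dvd m"
      using prod_d_seq_mult_m_seq[of a m 0] by (metis dvd_triv_right)
    then show ?case using *[of "m_seq a m 0" m] by simp
  next
    case (Suc i)
    have "m_seq a m (Suc i) dvd m_seq a m i"
      using d_seq_dvd[of a m i] by (metis div_dvd_iff_mult dvd_div_mult_self dvd_triv_left m_seq.simps(2))
    from *[OF this] Suc.IH show ?case by simp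
  qed
qed

lemma euler_theorem_int:
  assumes "coprime a k"
  shows "[a ^ totient_int k = 1] (mod k)"
proof (cases "k = 0")
  case True
  then show ?thesis by (simp add: totient_int_def)
next
  case False
  \<comment> \<open>\<open>euler_theorem\<close> is about naturals, so \<open>a\<close> is replaced
    by its residue modulo \<open>\<bar>k\<bar>\<close>.\<close>
  define b where "b = nat (a mod \<bar>k\<bar>)"
  have b: "int b = a mod \<bar>k\<bar>" using False by (simp add: b_def)
  have "coprime (int b) (int (nat \<bar>k\<bar>))"
    using assms False coprime_mod_left_iff[of "\<bar>k\<bar>" a] by (simp add: b)
  then have "[b ^ totient_int k = 1] (mod nat \<bar>k\<bar>)"
    unfolding totient_int_def by (intro euler_theorem) simp
  then have "[int b ^ totient_int k = 1] (mod \<bar>k\<bar>)"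
    by (metis cong_int_iff of_nat_power of_nat_1 int_nat_eq abs_ge_zero)
  moreover have "[int b ^ totient_int k = a ^ totient_int k] (mod \<bar>k\<bar>)"
    unfolding b by (intro cong_pow) (simp add: cong_def)
  ultimately have "[a ^ totient_int k = 1] (mod \<bar>k\<bar>)"
    by (metis cong_sym cong_trans)
  then show ?thesis by (simp add: cong_iff_dvd_diff)
qed

theorem theorem4p7:
  fixes a m :: int
  assumes "m \<noteq> 0"
  shows "[a ^ (totient_int (stop_modulus a m) + stop_index a m) = a ^ stop_index a m] (mod m)"
proof -
  let ?s = "stop_index a m" and ?k = "stop_modulus a m"
  have d: "d_seq a m ?s = 1"
    unfolding stop_index_def using stop_index_exists[OF assms] by (rule LeastI_ex)
  \<comment> \<open>The gcd is the term after \<open>?s\<close>, a divisor of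
    \<open>d_seq a m ?s = 1\<close>.\<close>
  then have "coprime a ?k"
    by (simp add: stop_modulus_def coprime_iff_gcd_eq_1 gcd_m_seq)
  then have "?k dvd a ^ totient_int ?k - 1"
    using euler_theorem_int cong_iff_dvd_diff by blast
  \<comment> \<open>Dropping the factor 1 at \<open>?s\<close> yields exponent \<open>?s\<close>
    instead of \<open>?s + 1\<close>.\<close>
  moreover have "(\<Prod>j<?s. d_seq a m j) * ?k = m"
    using prod_d_seq_mult_m_seq[of a m ?s] d
    by (simp add: stop_modulus_def flip: lessThan_Suc_atMost)
  ultimately have "m dvd a ^ ?s * (a ^ totient_int ?k - 1)"
    using mult_dvd_mono[OF prod_d_seq_dvd_power] by metis
  then show ?thesis
    by (simp add: cong_iff_dvd_diff power_add algebra_simps)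
qed

end
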